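(* (a) Let $(T,\langle -,-,-\rangle,\bullet,\alpha,\alpha)$ be an idempotent $\alpha$-Hom-truss of type $(2)$ such that $(T,\bullet,\alpha)$ is a Hom-group, with unit $1$. Then $(T,+_{1},\bullet,\alpha,\alpha)$, where $a+_{1}b=\langle a,1,b\rangle$, is an $\alpha$-Hom-brace of type $(2)$. (b) Conversely, if $(T,+,\bullet,\alpha,\alpha)$ is an idempotent $\alpha$-Hom-brace of type $(2)$, then, with the ternary operation $\langle a,b,c\rangle=a+\bigl(-\alpha^{-1}(b)+\alpha^{-1}(c)\bigr)$, $(T,\langle -,-,-\rangle,\bullet,\alpha,\alpha)$ is a unital $\alpha$-Hom-truss of type $(2)$.
   Context: "Idempotent" means $\alpha^{2}=\alpha$. A Hom-group (regular) $(G,\bullet,\alpha)$ is a set $G$ with a distinguished element $e$ (the unit), a bijective map $\alpha:G\to G$ and a binary operation $\bullet$ such that for all $a,b,c$: $\alpha(a)\bullet(b\bullet c)=(a\bullet b)\bullet\alpha(c)$; $\alpha(a\bullet b)=\alpha(a)\bullet\alpha(b)$; $a\bullet e=e\bullet a=\alpha(a)$; each $a$ has an inverse $a^{-1}$ with $a\bullet a^{-1}=a^{-1}\bullet a=e$. It is abelian if $a\bullet b=b\bullet a$. An abelian Hom-heap $(T,\langle -,-,-\rangle,\alpha)$ is a set $T$ with a bijective map $\alpha$ and a ternary operation such that: $\langle x,x,y\rangle=\alpha(y)=\langle y,x,x\rangle$; $\langle \alpha(e),\alpha(f),\langle x,y,z\rangle\rangle=\langle\langle e,f,x\rangle,\alpha(y),\alpha(z)\rangle$;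 $\alpha\langle x,y,z\rangle=\langle\alpha(x),\alpha(y),\alpha(z)\rangle$; $\langle x,y,z\rangle=\langle z,y,x\rangle$. A Hom-truss of type $(2)$ is $(T,\langle -,-,-\rangle,\bullet,\alpha,\beta)$ with $\alpha,\beta:T\to T$ bijective such that: $(T,\langle -,-,-\rangle,\alpha)$ is an abelian Hom-heap; $\beta\langle a,b,c\rangle=\langle\beta(a),\beta(b),\beta(c)\rangle$ and $\alpha\circ\beta=\beta\circ\alpha$; $\alpha,\beta$ are multiplicative for $\bullet$; $\beta(\alpha^{2}(a))\bullet(\beta(\alpha(b))\bullet\beta^{2}(c))=(\alpha^{2}(a)\bullet\beta(\alpha(b)))\bullet\beta^{2}(\alpha(c))$; $\alpha^{2}(a)\bullet\beta\langle b,c,d\rangle=\langle\alpha(a)\bullet\beta(b),\alpha(a)\bullet\beta(c),\alpha(a)\bullet\beta(d)\rangle$; $\alpha\langle a,b,c\rangle\bullet\alpha(\beta(d))=\langle\alpha(a)\bullet\beta(d),\alpha(b)\bullet\beta(d),\alpha(c)\bullet\beta(d)\rangle$. It is unital (unitary) if there is $1\in T$ with $a\bullet 1=\beta(a)$, $1\bullet a=\alpha(a)$ for all $a$, and $\alpha(1)=\beta(1)=1$. It is an $\alpha$-Hom-truss of type $(2)$ if $\alpha=\beta$. A Hom-brace of type $(2)$ is $(B,\star,\bullet,\alpha,\beta)$ with $\alpha,\beta:B\to B$ bijective such that: (i) $(B,\star,\alpha)$ is an abelian Hom-group; (ii) $(B,\bullet,\beta)$ is a Hom-group satisfying $\beta(\alpha^{2}(a))\bullet(\beta(\alpha(b))\bullet\beta^{2}(c))=(\alpha^{2}(a)\bullet\beta(\alpha(b)))\bullet\beta^{2}(\alpha(c))$;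 (iii) $\beta(a\star b)=\beta(a)\star\beta(b)$ and $\alpha\circ\beta=\beta\circ\alpha$; (iv) $\alpha(a\bullet b)=\alpha(a)\bullet\alpha(b)$; (v) $\alpha^{2}(a)\bullet\beta(b\star c)=(\alpha(a)\bullet\beta(b))\star\{\alpha(a^{\star})\star(\alpha(a)\bullet\beta(c))\}$ and $\alpha(b\star c)\bullet\alpha(\beta(a))=\{(\alpha(b)\bullet\beta(a))\star\alpha(a^{\star})\}\star(\alpha(c)\bullet\beta(a))$, for all $a,b,c\in B$, where $a^{\star}$ (written $-a$ in additive notation) is the inverse of $a$ with respect to $\star$. It is an $\alpha$-Hom-brace of type $(2)$ if $\alpha=\beta$. In the claim, $\star$ is $+_1$ in (a) and $+$ in (b). *)

theory Defs
  imports Main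
begin

text \<open>
  All structures live on an explicit carrier set; every operation is required to be
  closed on the carrier and its behaviour outside is irrelevant. Units are explicit
  parameters.
\<close>

locale hom_group =
  fixes G :: "'a set"
    and mult :: "'a \<Rightarrow> 'a \<Rightarrow> 'a" (infixl "\<bullet>" 70)
    and e :: 'a
    and \<alpha> :: "'a \<Rightarrow> 'a"
  assumes unit_closed: "e \<in> G"
    and mult_closed: "\<lbrakk>a \<in> G; b \<in> G\<rbrakk> \<Longrightarrow> a \<bullet> b \<in> G"
    and bij: "bij_betw \<alpha> G G"
    and hom_assoc: "\<lbrakk>a \<in> G; b \<in> G; c \<in> G\<rbrakk> \<Longrightarrow> \<alpha> a \<bullet> (b \<bullet> c) = (a \<bullet> b) \<bullet> \<alpha> c"
    and multiplicative: "\<lbrakk>a \<in> G; b \<in> G\<rbrakk> \<Longrightarrow> \<alpha> (a \<bullet> b) = \<alpha> a \<bullet> \<alpha> b"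
    and right_unit: "a \<in> G \<Longrightarrow> a \<bullet> e = \<alpha> a"
    and left_unit: "a \<in> G \<Longrightarrow> e \<bullet> a = \<alpha> a"
    and inverse_exists: "a \<in> G \<Longrightarrow> \<exists>b\<in>G. a \<bullet> b = e \<and> b \<bullet> a = e"

locale abelian_hom_group = hom_group +
  assumes commute: "\<lbrakk>a \<in> G; b \<in> G\<rbrakk> \<Longrightarrow> a \<bullet> b = b \<bullet> a"

text \<open>The description below is proper in every Hom-group, see \<open>inverse_unique\<close>.\<close>

definition hom_inv :: "'a set \<Rightarrow> ('a \<Rightarrow> 'a \<Rightarrow> 'a) \<Rightarrow> 'a \<Rightarrow> 'a \<Rightarrow> 'a" where
  "hom_inv G mult e a = (THE b. b \<in> G \<and> mult a b = e \<and> mult b a = e)"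

lemma (in hom_group) inverse_unique:
  assumes "a \<in> G"
  shows "\<exists>!b. b \<in> G \<and> a \<bullet> b = e \<and> b \<bullet> a = e"
proof -
  obtain b where b: "b \<in> G" "a \<bullet> b = e" "b \<bullet> a = e"
    using inverse_exists[OF assms] by blast
  moreover have "c = b" if c: "c \<in> G" "a \<bullet> c = e" for c
  proof -
    have cl: "\<alpha> x \<in> G" if "x \<in> G" for x
      using bij that by (auto simp: bij_betw_def)
    have "\<alpha> (\<alpha> b) = \<alpha> (\<alpha> c)"
      using hom_assoc[OF b(1) assms c(1)] b c right_unit[OF cl[OF b(1)]] left_unit[OF cl[OF c(1)]]
      by simp
    then show ?thesis
      using bij cl b(1) c(1) by (metis bij_betw_def inj_onD)
  qed
  ultimately show ?thesis by blast
qed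

locale abelian_hom_heap =
  fixes T :: "'a set"
    and br :: "'a \<Rightarrow> 'a \<Rightarrow> 'a \<Rightarrow> 'a" ("\<langle>_,/ _,/ _\<rangle>")
    and \<alpha> :: "'a \<Rightarrow> 'a"
  assumes br_closed: "\<lbrakk>x \<in> T; y \<in> T; z \<in> T\<rbrakk> \<Longrightarrow> \<langle>x, y, z\<rangle> \<in> T"
    and \<alpha>_bij: "bij_betw \<alpha> T T"
    and left_malcev: "\<lbrakk>x \<in> T; y \<in> T\<rbrakk> \<Longrightarrow> \<langle>x, x, y\<rangle> = \<alpha> y"
    and right_malcev: "\<lbrakk>x \<in> T; y \<in> T\<rbrakk> \<Longrightarrow> \<langle>y, x, x\<rangle> = \<alpha> y"
    and br_hom_assoc: "\<lbrakk>e \<in> T; f \<in> T; x \<in> T; y \<in> T; z \<in> T\<rbrakk> \<Longrightarrow>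
          \<langle>\<alpha> e, \<alpha> f, \<langle>x, y, z\<rangle>\<rangle> = \<langle>\<langle>e, f, x\<rangle>, \<alpha> y, \<alpha> z\<rangle>"
    and \<alpha>_br: "\<lbrakk>x \<in> T; y \<in> T; z \<in> T\<rbrakk> \<Longrightarrow> \<alpha> \<langle>x, y, z\<rangle> = \<langle>\<alpha> x, \<alpha> y, \<alpha> z\<rangle>"
    and br_commute: "\<lbrakk>x \<in> T; y \<in> T; z \<in> T\<rbrakk> \<Longrightarrow> \<langle>x, y, z\<rangle> = \<langle>z, y, x\<rangle>"

locale hom_truss2 = abelian_hom_heap T br \<alpha>
  for T :: "'a set"
    and br :: "'a \<Rightarrow> 'a \<Rightarrow> 'a \<Rightarrow> 'a" ("\<langle>_,/ _,/ _\<rangle>")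
    and mult :: "'a \<Rightarrow> 'a \<Rightarrow> 'a" (infixl "\<bullet>" 70)
    and \<alpha> :: "'a \<Rightarrow> 'a"
    and \<beta> :: "'a \<Rightarrow> 'a" +
  assumes mult_closed: "\<lbrakk>a \<in> T; b \<in> T\<rbrakk> \<Longrightarrow> a \<bullet> b \<in> T"
    and \<beta>_bij: "bij_betw \<beta> T T"
    and \<beta>_br: "\<lbrakk>a \<in> T; b \<in> T; c \<in> T\<rbrakk> \<Longrightarrow> \<beta> \<langle>a, b, c\<rangle> = \<langle>\<beta> a, \<beta> b, \<beta> c\<rangle>"
    and \<alpha>_\<beta>_commute: "a \<in> T \<Longrightarrow> \<alpha> (\<beta> a) = \<beta> (\<alpha> a)"
    and \<alpha>_mult: "\<lbrakk>a \<in> T; b \<in> T\<rbrakk> \<Longrightarrow> \<alpha> (a \<bullet> b) = \<alpha> a \<bullet> \<alpha> b"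
    and \<beta>_mult: "\<lbrakk>a \<in> T; b \<in> T\<rbrakk> \<Longrightarrow> \<beta> (a \<bullet> b) = \<beta> a \<bullet> \<beta> b"
    and mult_assoc2: "\<lbrakk>a \<in> T; b \<in> T; c \<in> T\<rbrakk> \<Longrightarrow>
          \<beta> (\<alpha> (\<alpha> a)) \<bullet> (\<beta> (\<alpha> b) \<bullet> \<beta> (\<beta> c)) = (\<alpha> (\<alpha> a) \<bullet> \<beta> (\<alpha> b)) \<bullet> \<beta> (\<beta> (\<alpha> c))"
    and left_distrib: "\<lbrakk>a \<in> T; b \<in> T; c \<in> T; d \<in> T\<rbrakk> \<Longrightarrow>
          \<alpha> (\<alpha> a) \<bullet> \<beta> \<langle>b, c, d\<rangle> = \<langle>\<alpha> a \<bullet> \<beta> b, \<alpha> a \<bullet> \<beta> c, \<alpha> a \<bullet> \<beta> d\<rangle>"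
    and right_distrib: "\<lbrakk>a \<in> T; b \<in> T; c \<in> T; d \<in> T\<rbrakk> \<Longrightarrow>
          \<alpha> \<langle>a, b, c\<rangle> \<bullet> \<alpha> (\<beta> d) = \<langle>\<alpha> a \<bullet> \<beta> d, \<alpha> b \<bullet> \<beta> d, \<alpha> c \<bullet> \<beta> d\<rangle>"

locale unital_hom_truss2 = hom_truss2 +
  assumes unital: "\<exists>u\<in>T. (\<forall>a\<in>T. a \<bullet> u = \<beta> a \<and> u \<bullet> a = \<alpha> a) \<and> \<alpha> u = u \<and> \<beta> u = u"

locale hom_brace2 =
  add: abelian_hom_group B star zero \<alpha> + mul: hom_group B mult one \<beta>
  for B :: "'a set"
    and star :: "'a \<Rightarrow> 'a \<Rightarrow> 'a" (infixl "\<star>" 65)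
    and zero :: 'a
    and mult :: "'a \<Rightarrow> 'a \<Rightarrow> 'a" (infixl "\<bullet>" 70)
    and one :: 'a
    and \<alpha> :: "'a \<Rightarrow> 'a"
    and \<beta> :: "'a \<Rightarrow> 'a" +
  assumes mult_assoc2: "\<lbrakk>a \<in> B; b \<in> B; c \<in> B\<rbrakk> \<Longrightarrow>
          \<beta> (\<alpha> (\<alpha> a)) \<bullet> (\<beta> (\<alpha> b) \<bullet> \<beta> (\<beta> c)) = (\<alpha> (\<alpha> a) \<bullet> \<beta> (\<alpha> b)) \<bullet> \<beta> (\<beta> (\<alpha> c))"
    and \<beta>_star: "\<lbrakk>a \<in> B; b \<in> B\<rbrakk> \<Longrightarrow> \<beta> (a \<star> b) = \<beta> a \<star> \<beta> b"
    and \<alpha>_\<beta>_commute: "a \<in> B \<Longrightarrow> \<alpha> (\<beta> a) = \<beta> (\<alpha> a)"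
    and \<alpha>_mult: "\<lbrakk>a \<in> B; b \<in> B\<rbrakk> \<Longrightarrow> \<alpha> (a \<bullet> b) = \<alpha> a \<bullet> \<alpha> b"
    and left_brace: "\<lbrakk>a \<in> B; b \<in> B; c \<in> B\<rbrakk> \<Longrightarrow>
          \<alpha> (\<alpha> a) \<bullet> \<beta> (b \<star> c) =
            (\<alpha> a \<bullet> \<beta> b) \<star> (\<alpha> (hom_inv B (\<star>) zero a) \<star> (\<alpha> a \<bullet> \<beta> c))"
    and right_brace: "\<lbrakk>a \<in> B; b \<in> B; c \<in> B\<rbrakk> \<Longrightarrow>
          \<alpha> (b \<star> c) \<bullet> \<alpha> (\<beta> a) =
            ((\<alpha> b \<bullet> \<beta> a) \<star> \<alpha> (hom_inv B (\<star>) zero a)) \<star> (\<alpha> c \<bullet> \<beta> a)"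

end

theory Submission
  imports Defs
begin

text \<open>
  An idempotent bijection is the identity, so the structures in question are an ordinary truss
  and an ordinary two-sided brace. In a brace \<open>0 = 1 0 = 1\<close>, and \<open>a (b + c) = a b - a + a c\<close>
  for \<open>b = - c\<close> yields \<open>a (- c) = a - a c + a\<close>, from which the truss law
  \<open>a (b - c + d) = a b - a c + a d\<close> follows.
\<close>

text \<open>Injectivity cancels one \<open>f\<close> from \<open>f (f x) = f x\<close>.\<close>

lemma idempotent_bij_betw_id:
  assumes "bij_betw f A A" and "\<forall>x\<in>A. f (f x) = f x" and "x \<in> A"
  shows "f x = x"
  using assms by (metis bij_betwE bij_betw_imp_inj_on inj_onD)

context hom_group
begin

abbreviation inv' :: "'a \<Rightarrow> 'a" where
  "inv' a \<equiv> hom_inv G (\<bullet>) e a"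

lemma
  assumes "a \<in> G"
  shows hom_inv_closed: "inv' a \<in> G"
    and right_inverse: "a \<bullet> inv' a = e"
    and left_inverse: "inv' a \<bullet> a = e"
  using theI'[OF inverse_unique[OF assms]] unfolding hom_inv_def by auto

lemma hom_inv_eqI:
  assumes "a \<in> G" "b \<in> G" "a \<bullet> b = e" "b \<bullet> a = e"
  shows "inv' a = b"
  using inverse_unique[OF assms(1)] assms hom_inv_closed left_inverse right_inverse by blast

end

text \<open>Triviality of \<open>\<alpha>\<close> is asked on the carrier only: idempotence there
  says nothing about other points.\<close>

locale abelian_untwisted_group = abelian_hom_group +
  assumes untwisted: "x \<in> G \<Longrightarrow> \<alpha> x = x"
begin

lemma assoc: "\<lbrakk>a \<in> G; b \<in> G; c \<in> G\<rbrakk> \<Longrightarrow> (a \<bullet> b) \<bullet> c = a \<bullet> (b \<bullet> c)"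
  using hom_assoc untwisted by simp

lemma left_commute: "\<lbrakk>a \<in> G; b \<in> G; c \<in> G\<rbrakk> \<Longrightarrow> a \<bullet> (b \<bullet> c) = b \<bullet> (a \<bullet> c)"
  by (metis assoc commute)

lemma unit_simps: "a \<in> G \<Longrightarrow> a \<bullet> e = a" "a \<in> G \<Longrightarrow> e \<bullet> a = a"
  by (simp_all add: right_unit left_unit untwisted)

lemma cancel_left: "\<lbrakk>a \<in> G; b \<in> G\<rbrakk> \<Longrightarrow> a \<bullet> (inv' a \<bullet> b) = b"
  by (metis assoc hom_inv_closed right_inverse unit_simps(2))

lemma cancel_left': "\<lbrakk>a \<in> G; b \<in> G\<rbrakk> \<Longrightarrow> inv' a \<bullet> (a \<bullet> b) = b"
  by (metis assoc hom_inv_closed left_inverse unit_simps(2))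

lemma cancel_right: "\<lbrakk>a \<in> G; b \<in> G\<rbrakk> \<Longrightarrow> a \<bullet> (b \<bullet> inv' a) = b"
  by (metis cancel_left commute hom_inv_closed)

lemma cancel_right': "\<lbrakk>a \<in> G; b \<in> G\<rbrakk> \<Longrightarrow> inv' a \<bullet> (b \<bullet> a) = b"
  by (metis cancel_left' commute)

lemma inv_distrib:
  assumes "a \<in> G" "b \<in> G"
  shows "inv' (a \<bullet> b) = inv' a \<bullet> inv' b"
proof (rule hom_inv_eqI)
  show "(a \<bullet> b) \<bullet> (inv' a \<bullet> inv' b) = e"
    by (simp add: assms assoc cancel_left commute[of "inv' a"] right_inverse hom_inv_closed mult_closed)
  then show "(inv' a \<bullet> inv' b) \<bullet> (a \<bullet> b) = e"
    by (simp add: assms commute hom_inv_closed mult_closed)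
qed (simp_all add: assms hom_inv_closed mult_closed)

lemma inv_inv: "a \<in> G \<Longrightarrow> inv' (inv' a) = a"
  by (simp add: hom_inv_eqI hom_inv_closed left_inverse right_inverse)

text \<open>Ordered rewriting sorts a sum, so an element and its inverse may end up adjacent or at
  the two ends of a triple, hence the four cancellation rules.\<close>

lemmas group_simps = mult_closed hom_inv_closed unit_closed assoc commute left_commute
  unit_simps cancel_left cancel_left' cancel_right cancel_right' left_inverse right_inverse inv_distrib inv_inv

lemma inv_into_untwisted: "x \<in> G \<Longrightarrow> inv_into G \<alpha> x = x"
  by (metis bij bij_betw_imp_inj_on inv_into_f_f untwisted)

text \<open>With \<open>\<alpha>\<close> and its inverse trivial on the carrier, the operation is a
  - b + c, the standard heap of an abelian group, and each axiom is an identity between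
  sums.\<close>

lemma abelian_hom_heap:
  "abelian_hom_heap G (\<lambda>a b c. a \<bullet> (inv' (inv_into G \<alpha> b) \<bullet> inv_into G \<alpha> c)) \<alpha>"
  by unfold_locales (simp_all add: bij untwisted inv_into_untwisted group_simps)

end

locale untwisted_brace = hom_brace2 B star zero mult one \<alpha> \<alpha>
  for B :: "'a set"
    and star (infixl "\<star>" 65) and zero and mult (infixl "\<bullet>" 70) and one and \<alpha> +
  assumes untwisted_add: "x \<in> B \<Longrightarrow> \<alpha> x = x"
begin

sublocale grp: abelian_untwisted_group B "(\<star>)" zero \<alpha>
  by unfold_locales (rule untwisted_add)

lemma left_brace': "\<lbrakk>a \<in> B; b \<in> B; c \<in> B\<rbrakk> \<Longrightarrow>
    a \<bullet> (b \<star> c) = (a \<bullet> b) \<star> (add.inv' a \<star> (a \<bullet> c))"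
  using left_brace[of a b c]
  by (simp add: untwisted_add add.hom_inv_closed add.mult_closed mul.mult_closed)

text \<open>Reassociated to the right so that it has the same shape as
  \<open>left_brace'\<close>.\<close>

lemma right_brace': "\<lbrakk>a \<in> B; b \<in> B; c \<in> B\<rbrakk> \<Longrightarrow>
    (b \<star> c) \<bullet> a = (b \<bullet> a) \<star> (add.inv' a \<star> (c \<bullet> a))"
  using right_brace[of a b c]
  by (simp add: untwisted_add add.hom_inv_closed add.mult_closed grp.assoc mul.mult_closed)

text \<open>Both brace laws are instances of \<open>f (b + c) = f b - a + f c\<close>, for left resp. right
  multiplication \<open>f\<close> by \<open>a\<close>; such an \<open>f\<close> preserves the heap operation.\<close>

lemma affine_heap_hom:
  assumes f: "\<And>b. b \<in> B \<Longrightarrow> f b \<in> B" "f zero = a" and a: "a \<in> B"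
    and affine: "\<And>b c. \<lbrakk>b \<in> B; c \<in> B\<rbrakk> \<Longrightarrow> f (b \<star> c) = f b \<star> (add.inv' a \<star> f c)"
    and "b \<in> B" "c \<in> B" "d \<in> B"
  shows "f (b \<star> (add.inv' c \<star> d)) = f b \<star> (add.inv' (f c) \<star> f d)"
proof -
  \<comment> \<open>The affine law at c + (-c) = 0, where \<open>f\<close> takes the value
    \<open>a\<close>. Solving for the second summand gives f(-c) = a - f(c) + a.\<close>
  have "f c \<star> (add.inv' a \<star> f (add.inv' c)) = a"
    using affine[of c "add.inv' c"] assms by (simp add: grp.group_simps)
  then have "f (add.inv' c) = a \<star> (add.inv' (f c) \<star> a)"
    using assms
    by (metis grp.cancel_left' add.hom_inv_closed grp.left_commute add.mult_closed grp.inv_inv)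
  then have "add.inv' a \<star> f (add.inv' c) = add.inv' (f c) \<star> a"
    using assms by (simp add: grp.cancel_left' add.hom_inv_closed add.mult_closed)
  \<comment> \<open>Applying the affine law twice to b + (-c + d) leaves this expression after f(b).
    Its two corrections -a absorb both copies of \<open>a\<close> in f(-c).\<close>
  then have "add.inv' a \<star> (f (add.inv' c) \<star> (add.inv' a \<star> f d)) = add.inv' (f c) \<star> f d"
    using assms by (metis grp.assoc grp.cancel_left add.hom_inv_closed add.mult_closed)
  then show ?thesis
    using assms by (simp add: affine add.hom_inv_closed add.mult_closed)
qed

text \<open>The two units coincide, so multiplying by \<open>zero\<close> is applying the trivial
  \<open>\<alpha>\<close>. This supplies the hypothesis \<open>f zero = a\<close> of
  \<open>affine_heap_hom\<close>.\<close>

lemma mult_zero: "a \<in> B \<Longrightarrow> a \<bullet> zero = a" "a \<in> B \<Longrightarrow> zero \<bullet> a = a"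
proof -
  have "zero = one \<bullet> zero"
    by (simp add: mul.left_unit add.unit_closed untwisted_add)
  also have "\<dots> = one"
  proof -
    \<comment> \<open>Both products on the right of the brace law are again 1 0 = 0, so it reads 0 =
      0 + (-1 + 0) and forces -1 = 0.\<close>
    have "one \<bullet> zero = zero \<star> (add.inv' one \<star> zero)"
      using left_brace'[of one zero zero]
      by (simp add: mul.unit_closed mul.left_unit add.unit_closed grp.unit_simps untwisted_add)
    then have "add.inv' one = zero"
      by (simp add: mul.unit_closed mul.left_unit grp.group_simps untwisted_add)
    then show ?thesis
      by (metis calculation add.right_inverse grp.unit_simps(1) mul.unit_closed)
  qed
  finally have "zero = one" .
  then show "a \<in> B \<Longrightarrow> a \<bullet> zero = a" "a \<in> B \<Longrightarrow> zero \<bullet> a = a"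
    by (simp_all add: mul.left_unit mul.right_unit untwisted_add)
qed

lemma unital_hom_truss2:
  "unital_hom_truss2 B
     (\<lambda>a b c. a \<star> (add.inv' (inv_into B \<alpha> b) \<star> inv_into B \<alpha> c)) (\<bullet>) \<alpha> \<alpha>"
proof (intro unital_hom_truss2.intro hom_truss2.intro grp.abelian_hom_heap
    hom_truss2_axioms.intro unital_hom_truss2_axioms.intro)
  \<comment> \<open>Distributivity is proved in plain form first; \<open>\<alpha>\<close> and
    \<open>inv_into B \<alpha>\<close> are then removed from the actual axiom by
    simplification.\<close>
  have "a \<bullet> (b \<star> (add.inv' c \<star> d)) = a \<bullet> b \<star> (add.inv' (a \<bullet> c) \<star> a \<bullet> d)"
    if "a \<in> B" "b \<in> B" "c \<in> B" "d \<in> B" for a b c d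
    using that
    by (intro affine_heap_hom[where a = a]) (simp_all add: left_brace' mult_zero mul.mult_closed)
  then show "\<alpha> (\<alpha> a) \<bullet> \<alpha> (b \<star> (add.inv' (inv_into B \<alpha> c) \<star> inv_into B \<alpha> d))
      = \<alpha> a \<bullet> \<alpha> b \<star> (add.inv' (inv_into B \<alpha> (\<alpha> a \<bullet> \<alpha> c)) \<star> inv_into B \<alpha> (\<alpha> a \<bullet> \<alpha> d))"
    if "a \<in> B" "b \<in> B" "c \<in> B" "d \<in> B" for a b c d
    using that by (simp add: grp.inv_into_untwisted untwisted_add add.hom_inv_closed
        add.mult_closed mul.mult_closed)
  have "(a \<star> (add.inv' b \<star> c)) \<bullet> d = a \<bullet> d \<star> (add.inv' (b \<bullet> d) \<star> c \<bullet> d)"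
    if "a \<in> B" "b \<in> B" "c \<in> B" "d \<in> B" for a b c d
    using that
    by (intro affine_heap_hom[where a = d and f = "\<lambda>x. x \<bullet> d"])
      (simp_all add: right_brace' mult_zero mul.mult_closed)
  then show "\<alpha> (a \<star> (add.inv' (inv_into B \<alpha> b) \<star> inv_into B \<alpha> c)) \<bullet> \<alpha> (\<alpha> d)
      = \<alpha> a \<bullet> \<alpha> d \<star> (add.inv' (inv_into B \<alpha> (\<alpha> b \<bullet> \<alpha> d)) \<star> inv_into B \<alpha> (\<alpha> c \<bullet> \<alpha> d))"
    if "a \<in> B" "b \<in> B" "c \<in> B" "d \<in> B" for a b c d
    using that by (simp add: grp.inv_into_untwisted untwisted_add add.hom_inv_closed
        add.mult_closed mul.mult_closed)
  show "\<exists>u\<in>B. (\<forall>a\<in>B. a \<bullet> u = \<alpha> a \<and> u \<bullet> a = \<alpha> a) \<and> \<alpha> u = u \<and> \<alpha> u = u"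
    by (intro bexI[of _ one]) (simp_all add: mul.unit_closed mul.left_unit mul.right_unit untwisted_add)
\<comment> \<open>Twisted associativity collapses to ordinary associativity, which is
  \<open>mul.hom_assoc\<close> for trivial \<open>\<alpha>\<close>.\<close>
qed (use mul.hom_assoc in \<open>simp_all add: add.bij grp.inv_into_untwisted untwisted_add
    add.hom_inv_closed add.mult_closed mul.mult_closed\<close>)

end

text \<open>The sum is the retract of the heap at \<open>one\<close>, so the multiplicative unit
  also serves as the zero.\<close>

lemma untwisted_truss_hom_brace2:
  assumes "hom_truss2 T br mult \<alpha> \<alpha>" and "hom_group T mult one \<alpha>"
    and id: "\<And>x. x \<in> T \<Longrightarrow> \<alpha> x = x"
  shows "hom_brace2 T (\<lambda>a b. br a one b) one mult one \<alpha> \<alpha>"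
proof -
  interpret T: hom_truss2 T br mult \<alpha> \<alpha> by fact
  interpret M: hom_group T mult one \<alpha> by fact
  note [simp] = id M.unit_closed T.br_closed M.mult_closed T.left_malcev T.right_malcev
  have assoc: "br (br e f x) y z = br e f (br x y z)"
    if "e \<in> T" "f \<in> T" "x \<in> T" "y \<in> T" "z \<in> T" for e f x y z
    using T.br_hom_assoc[OF that] that by simp
  interpret A: abelian_hom_group T "\<lambda>a b. br a one b" one \<alpha>
  proof unfold_locales
    \<comment> \<open>The negative of a is [1,a,1]: reassociating, [a,1,[1,a,1]] = [[a,1,1],a,1] =
      [a,a,1] = 1.\<close>
    show "\<exists>b\<in>T. br a one b = one \<and> br b one a = one" if "a \<in> T" for a
      using that assoc[of one a one one a] assoc[of a one one a one]
      by (intro bexI[of _ "br one a one"]) simp_all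
  qed (auto simp: T.\<alpha>_bij assoc intro: T.br_commute)
  have inv: "A.inv' a = br one a one" if "a \<in> T" for a
    using that assoc[of one a one one a] assoc[of a one one a one]
    by (intro A.hom_inv_eqI) simp_all
  show ?thesis
  proof unfold_locales
    \<comment> \<open>Distributing over [b,1,c] gives [ab,a,ac], since a1 = a. The right-hand side
      is [ab,1,[1,a,ac]], which reassociates to the same bracket.\<close>
    show "mult (\<alpha> (\<alpha> a)) (\<alpha> (br b one c)) =
        br (mult (\<alpha> a) (\<alpha> b)) one (br (\<alpha> (A.inv' a)) one (mult (\<alpha> a) (\<alpha> c)))"
      if "a \<in> T" "b \<in> T" "c \<in> T" for a b c
      using that T.left_distrib[of a b one c] assoc[of "mult a b" one one a "mult a c"]
      by (simp add: inv assoc M.right_unit)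
    show "mult (\<alpha> (br b one c)) (\<alpha> (\<alpha> a)) =
        br (br (mult (\<alpha> b) (\<alpha> a)) one (\<alpha> (A.inv' a))) one (mult (\<alpha> c) (\<alpha> a))"
      if "a \<in> T" "b \<in> T" "c \<in> T" for a b c
      using that T.right_distrib[of b one c a] assoc[of "mult b a" one one a "mult c a"]
      by (simp add: inv assoc M.left_unit)
  qed (use M.hom_assoc in simp_all)
qed

theorem corollary6p9:
  fixes T :: "'a set"
    and br :: "'a \<Rightarrow> 'a \<Rightarrow> 'a \<Rightarrow> 'a"
    and mult plus :: "'a \<Rightarrow> 'a \<Rightarrow> 'a"
    and zero one :: 'a
    and \<alpha> :: "'a \<Rightarrow> 'a"
  shows
    "(hom_truss2 T br mult \<alpha> \<alpha> \<and> (\<forall>x\<in>T. \<alpha> (\<alpha> x) = \<alpha> x) \<and> hom_group T mult one \<alpha>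
        \<longrightarrow> (\<exists>z. hom_brace2 T (\<lambda>a b. br a one b) z mult one \<alpha> \<alpha>))
     \<and>
     (hom_brace2 T plus zero mult one \<alpha> \<alpha> \<and> (\<forall>x\<in>T. \<alpha> (\<alpha> x) = \<alpha> x)
        \<longrightarrow> unital_hom_truss2 T
              (\<lambda>a b c. plus a (plus (hom_inv T plus zero (inv_into T \<alpha> b)) (inv_into T \<alpha> c)))
              mult \<alpha> \<alpha>)"
proof (intro conjI impI; elim conjE)
  assume "hom_truss2 T br mult \<alpha> \<alpha>" "hom_group T mult one \<alpha>" "\<forall>x\<in>T. \<alpha> (\<alpha> x) = \<alpha> x"
  then show "\<exists>z. hom_brace2 T (\<lambda>a b. br a one b) z mult one \<alpha> \<alpha>"
    \<comment> \<open>The witness for \<open>z\<close> is \<open>one\<close>.\<close>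
    using untwisted_truss_hom_brace2 idempotent_bij_betw_id hom_group.bij by metis
next
  assume brace: "hom_brace2 T plus zero mult one \<alpha> \<alpha>" and idem: "\<forall>x\<in>T. \<alpha> (\<alpha> x) = \<alpha> x"
  interpret hom_brace2 T plus zero mult one \<alpha> \<alpha> by fact
  interpret untwisted_brace T plus zero mult one \<alpha>
    by unfold_locales (rule idempotent_bij_betw_id[OF add.bij idem])
  show "unital_hom_truss2 T
      (\<lambda>a b c. plus a (plus (hom_inv T plus zero (inv_into T \<alpha> b)) (inv_into T \<alpha> c))) mult \<alpha> \<alpha>"
    by (rule unital_hom_truss2)
qed

end
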